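(* Let $\widetilde{\mu}_N=\frac1N\sum_{i=1}^N X_i$, where the $X_i$ are independent Gaussian vectors in $\mathbb{R}^d$ with mean $\mu$ and covariance matrix $\Sigma$. Suppose that there exists a constant $C$ such that, for all $\delta\in(0,1)$, $N$, $\mu$ and $\Sigma$, with probability at least $1-\delta$, $$\forall u\in S^{d-1}:\quad\langle\widetilde{\mu}_N-\mu,u\rangle\le C\sqrt{\frac{\sigma^2(u)\log(1/\delta)}{N}}+S.$$ Then there exists a constant $C'$ depending on $C$ only, such that the "strong term" $S$ has to satisfy $$S\ge C'\sqrt{\frac{\sum_{i>k_0}\lambda_i}{N}},\qquad\text{where }k_0=1+(2C+\sqrt2)^2\log(1/\delta).$$
   Context: $S^{d-1}$ is the Euclidean unit sphere in $\mathbb{R}^d$ and $\langle\cdot,\cdot\rangle$ is the standard inner product; $\sigma^2(u)=\mathrm{Var}(\langle X_1,u\rangle)=\langle\Sigma u,u\rangle$; $\lambda_1\ge\lambda_2\ge\cdots\ge\lambda_d\ge0$ are the eigenvalues of $\Sigma$, and the sum is over integers $i$ with $k_0<i\le d$. The constants $C$ and $C'$ are positive. The strong term $S$ is a deterministic quantity that does not depend on the direction $u$ but may depend on $\delta,N,\mu,\Sigma$.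
   Formalization: The lower bound on S is stated only for δ ≤ 1/2 and k_0 < d: it is false for δ near 1 (d=2, Σ=I, S the (1−δ)-quantile of the norm tends to 0 while the sum is 1), and for k_0 ≥ d the sum is empty and S may be negative. The assumption on S is kept for all δ in (0,1). *)

theory Defs
  imports "HOL-Probability.Probability" "Jordan_Normal_Form.Char_Poly"
begin

(* HOL-Analysis and Jordan_Normal_Form both provide types of vectors; below, vectors and
   matrices are those of Jordan_Normal_Form, whose dimension is a natural number that can be
   quantified over. *)
unbundle no vec_syntax
no_notation inner (infix "\<bullet>" 70)

type_synonym rvec = "real Matrix.vec"
type_synonym rmat = "real Matrix.mat"

text \<open>The Borel sigma-algebra of d-dimensional Euclidean space, generated by the coordinates.\<close>

definition borel_vec :: "nat \<Rightarrow> rvec measure" where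
  "borel_vec d = vimage_algebra (carrier_vec d) (\<lambda>v. \<lambda>i\<in>{..<d}. vec_index v i)
     (\<Pi>\<^sub>M i\<in>{..<d}. (borel :: real measure))"

definition unit_sphere :: "nat \<Rightarrow> rvec set" where
  "unit_sphere d = {u \<in> carrier_vec d. sqrt (scalar_prod u u) = 1}"

text \<open>The univariate normal law with mean m and standard deviation s; for s = 0 it is the
  point mass at m, so that singular covariance matrices are covered.\<close>

definition normal_law :: "real \<Rightarrow> real \<Rightarrow> real measure" where
  "normal_law m s = (if s = 0 then return borel m else density lborel (normal_density m s))"

definition gaussian_vector :: "'a measure \<Rightarrow> nat \<Rightarrow> ('a \<Rightarrow> rvec) \<Rightarrow> bool" where
  "gaussian_vector M d X \<longleftrightarrow>
     X \<in> measurable M (borel_vec d) \<and>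
     (\<forall>v \<in> carrier_vec d. \<exists>m s. 0 \<le> s \<and>
        distr M borel (\<lambda>\<omega>. scalar_prod (X \<omega>) v) = normal_law m s)"

definition has_mean :: "'a measure \<Rightarrow> nat \<Rightarrow> ('a \<Rightarrow> rvec) \<Rightarrow> rvec \<Rightarrow> bool" where
  "has_mean M d X \<mu> \<longleftrightarrow> \<mu> \<in> carrier_vec d \<and>
     (\<forall>i<d. integrable M (\<lambda>\<omega>. vec_index (X \<omega>) i) \<and>
        integral\<^sup>L M (\<lambda>\<omega>. vec_index (X \<omega>) i) = vec_index \<mu> i)"

definition has_covariance :: "'a measure \<Rightarrow> nat \<Rightarrow> ('a \<Rightarrow> rvec) \<Rightarrow> rmat \<Rightarrow> bool" where
  "has_covariance M d X A \<longleftrightarrow> A \<in> carrier_mat d d \<and>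
     (\<forall>i<d. \<forall>j<d.
        (let cross = (\<lambda>\<omega>. (vec_index (X \<omega>) i - integral\<^sup>L M (\<lambda>\<omega>. vec_index (X \<omega>) i)) *
                         (vec_index (X \<omega>) j - integral\<^sup>L M (\<lambda>\<omega>. vec_index (X \<omega>) j)))
         in integrable M cross \<and> integral\<^sup>L M cross = index_mat A (i, j)))"

definition gaussian_sample ::
    "'a measure \<Rightarrow> nat \<Rightarrow> nat \<Rightarrow> rvec \<Rightarrow> rmat \<Rightarrow> (nat \<Rightarrow> 'a \<Rightarrow> rvec) \<Rightarrow> bool" where
  "gaussian_sample M d N \<mu> A X \<longleftrightarrow>
     prob_space M \<and>
     prob_space.indep_vars M (\<lambda>_. borel_vec d) X {1..N} \<and>
     (\<forall>i\<in>{1..N}. gaussian_vector M d (X i) \<and> has_mean M d (X i) \<mu> \<and>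
        has_covariance M d (X i) A)"

definition empirical_mean :: "nat \<Rightarrow> nat \<Rightarrow> (nat \<Rightarrow> 'a \<Rightarrow> rvec) \<Rightarrow> 'a \<Rightarrow> rvec" where
  "empirical_mean d N X \<omega> = Matrix.vec d (\<lambda>j. (\<Sum>i=1..N. vec_index (X i \<omega>) j) / real N)"

definition dir_variance :: "rmat \<Rightarrow> rvec \<Rightarrow> real" where
  "dir_variance A u = scalar_prod (A *\<^sub>v u) u"

text \<open>The eigenvalues are listed in decreasing order, with multiplicity, as
  \<open>lam 1, \<dots>, lam d\<close>; the values of \<open>lam\<close> outside \<open>{1..d}\<close> are irrelevant.\<close>

definition ordered_eigenvalues :: "nat \<Rightarrow> rmat \<Rightarrow> (nat \<Rightarrow> real) \<Rightarrow> bool" where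
  "ordered_eigenvalues d A lam \<longleftrightarrow>
     char_poly A = (\<Prod>i=1..d. [:- lam i, 1:]) \<and>
     (\<forall>i j. 1 \<le> i \<and> i \<le> j \<and> j \<le> d \<longrightarrow> lam j \<le> lam i)"

definition k_zero :: "real \<Rightarrow> real \<Rightarrow> real" where
  "k_zero C \<delta> = 1 + (2 * C + sqrt 2)\<^sup>2 * ln (1 / \<delta>)"

end

theory Submission
  imports Defs "Jordan_Normal_Form.Schur_Decomposition"
begin

text \<open>
  Write $e_1, \dots, e_d$ for an orthonormal eigenbasis of $\Sigma$, $\nu_j = \lambda_j / N$ for the
  variance of $Y_j = \langle \widetilde\mu_N - \mu, e_j \rangle$, and $L = \log(1/\delta)$. Let
  $m = \lfloor k_0 \rfloor + 1$, so that $\{m, \dots, d\}$ is the range of the sum, and suppose first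
  that $\theta = \nu_m > 0$. The hypothesis is tested against the direction of the random vector
  $v = \sum_j c_j Y_j e_j$ with $c_j = 1 / \max(\nu_j, \theta)$. Put
  $Q = \sum_j c_j Y_j^2 = \langle \widetilde\mu_N - \mu, v \rangle$. Since $c_j \nu_j \le 1$ and
  $c_j \theta \le 1$, both $\sigma^2(v) / N$ and $\theta |v|^2$ are at most $Q$. Hence
  $S \ge \sqrt\theta (\sqrt Q - C \sqrt L)$ at every point where the bound of the hypothesis holds and
  $\sqrt Q \ge C \sqrt L$, $Q > 0$ (\<open>ellipsoid_test_direction\<close>).

  The mean of $Q$ is $P = \sum_j c_j \nu_j$. The first $m$ summands are 1 and the others are
  $\nu_j / \theta$, so $P \ge m > (2 C + \sqrt 2)^2 L$ and $\theta P \ge \sum_{j \ge m} \nu_j$. If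
  $Q > P / 4$ then $\sqrt Q > (C + 1 / \sqrt 2) \sqrt L$, so a fixed fraction of $\sqrt Q$ survives the
  subtraction of $C \sqrt L$, and $S \ge C' \sqrt{\theta P}$ with $C' = 1 / (2 (\sqrt 2 C + 1))$
  (\<open>gaussian_strong_term_lower_bound\<close>). The bound of the hypothesis holds with probability at least
  $1 - \delta \ge 1/2$. So it suffices that $Q \le P / 4$ has probability less than $1/2$: then the
  bound and $Q > P / 4$ hold together at some point. If $\theta = 0$ the sum vanishes, and the
  directions $\pm e_m$ give $S \ge 0$.

  The lower tail of $Q$ comes from its Laplace transform
  $\prod_j (1 + 2 s c_j \nu_j)^{-1/2}$ at $s = 3/2$ (\<open>gaussian_squares_lower_tail\<close>). This is computed
  from the joint characteristic function of the $Y_j$, without densities: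
  each $\exp(- s c_j Y_j^2)$ is the average of $\exp(\mathrm{i} \sqrt{2 s c_j} h_j Y_j)$ over a standard
  normal $h_j$, and Fubini's theorem exchanges the averages over the $h_j$ with the expectation
  (\<open>laplace_transform_gaussian_squares\<close>).
\<close>

section \<open>Orthogonal diagonalisation of symmetric matrices\<close>

lemma orthonormal_extension:
  fixes v :: rvec
  assumes v: "v \<in> carrier_vec n" and v1: "v \<noteq> 0\<^sub>v n"
  obtains W c where "W \<in> carrier_mat n n" "transpose_mat W * W = 1\<^sub>m n" "c \<noteq> 0" "col W 0 = c \<cdot>\<^sub>v v"
proof -
  interpret cof_vec_space n "TYPE(real)" .
  define b where "b = basis_completion v"
  define ws where "ws = gram_schmidt n b"
  from basis_completion[OF v v1, folded b_def]
  have dist_b: "distinct b" and indep: "\<not> lin_dep (set b)" and b: "set b \<subseteq> carrier_vec n"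
    and hdb: "hd b = v" and len_b: "length b = n" by auto
  have n: "n \<noteq> 0" using v v1 by (auto simp: zero_vec_def)
  from hdb len_b n obtain vs where bv: "b = v # vs" by (cases b, auto)
  from gram_schmidt_result[OF b dist_b indep refl, folded ws_def]
  have ws: "set ws \<subseteq> carrier_vec n" "corthogonal ws" "length ws = n"
    by (auto simp: len_b)
  have hdws: "ws ! 0 = v" using gram_schmidt_hd[OF v, of vs, folded bv] ws(3) n
    unfolding ws_def by (metis hd_conv_nth length_0_conv)
  have dot: "(scalar_prod (ws ! i) (ws ! j) = 0) = (i \<noteq> j)" if "i < n" "j < n" for i j
    using corthogonalD[OF ws(2), of i j] that ws(3) by simp
  have pos: "scalar_prod (ws ! i) (ws ! i) > 0" if "i < n" for i
    using dot[OF that that] by (force simp: scalar_prod_def order.strict_iff_order intro!: sum_nonneg)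
  \<comment> \<open>Gram-Schmidt keeps the first vector and yields an orthogonal basis; \<open>q\<close> normalises it.\<close>
  define q where "q i = 1 / sqrt (scalar_prod (ws ! i) (ws ! i))" for i
  define W where "W = mat_of_cols n (map (\<lambda>i. q i \<cdot>\<^sub>v (ws ! i)) [0..<n])"
  have W: "W \<in> carrier_mat n n" unfolding W_def using mat_of_cols_carrier(1)[of n "map (\<lambda>i. q i \<cdot>\<^sub>v (ws ! i)) [0..<n]"] by simp
  have wsc: "ws ! i \<in> carrier_vec n" if "i < n" for i using ws that by auto
  have colW: "col W i = q i \<cdot>\<^sub>v (ws ! i)" if "i < n" for i
    unfolding W_def using that wsc[OF that] by (subst col_mat_of_cols) auto
  have "transpose_mat W * W = 1\<^sub>m n"
  proof (rule eq_matI)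
    fix i j assume ij: "i < dim_row (1\<^sub>m n :: rmat)" "j < dim_col (1\<^sub>m n :: rmat)"
    hence i: "i < n" and j: "j < n" by auto
    have "(transpose_mat W * W) $$ (i, j) = scalar_prod (col W i) (col W j)"
      using W i j by auto
    also have "\<dots> = q i * q j * scalar_prod (ws ! i) (ws ! j)"
      unfolding colW[OF i] colW[OF j] using wsc[OF i] wsc[OF j] by simp
    also have "\<dots> = (if i = j then 1 else 0)"
    proof (cases "i = j")
      case True
      have "sqrt (scalar_prod (ws ! i) (ws ! i)) * sqrt (scalar_prod (ws ! i) (ws ! i)) = scalar_prod (ws ! i) (ws ! i)"
        using pos[OF i] by simp
      thus ?thesis using pos[OF i] True by (simp add: q_def field_simps)
    qed (use dot[OF i j] in auto)
    finally show "(transpose_mat W * W) $$ (i, j) = 1\<^sub>m n $$ (i, j)" using i j by simp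
  qed (use W in auto)
  moreover have "q 0 \<noteq> 0" using pos[of 0] n by (auto simp: q_def)
  ultimately show thesis using that[OF W] colW[of 0] n hdws by auto
qed

text \<open>The spectral theorem with the eigenvalues in a prescribed order. As in the construction of the
  Schur form, an eigenvector of the first eigenvalue is split off and the induction continues on the
  complementary block, which is again symmetric.\<close>

lemma symmetric_orthogonal_diagonalization:
  fixes A :: rmat
  assumes "A \<in> carrier_mat n n" "transpose_mat A = A"
    and "char_poly A = (\<Prod>e\<leftarrow>es. [:- e, 1:])"
  shows "\<exists>U \<in> carrier_mat n n. transpose_mat U * U = 1\<^sub>m n \<and>
           transpose_mat U * A * U = mat n n (\<lambda>(i, j). if i = j then es ! i else 0)"
  using assms
proof (induct es arbitrary: n A)
  case Nil
  with degree_monic_char_poly[of A n] have "n = 0" by auto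
  thus ?case using Nil by (intro bexI[of _ "1\<^sub>m 0"]) auto
next
  case (Cons e es n A)
  let ?m = "n - 1"
  note A = Cons(2) and sym = Cons(3)
  have cp: "char_poly A = [: -e, 1 :] * (\<Prod>e \<leftarrow> es. [:- e, 1:])" using Cons(4) by auto
  have mon: "monic (\<Prod>e\<leftarrow> es. [:- e, 1:])" by (rule monic_prod_list, auto)
  have deg: "degree (char_poly A) = Suc (degree (\<Prod>e\<leftarrow> es. [:- e, 1:]))" unfolding cp
    by (subst degree_mult_eq, insert mon, auto)
  with degree_monic_char_poly[OF A] have n: "n \<noteq> 0" by auto
  have "eigenvalue A e" unfolding eigenvalue_root_char_poly[OF A] cp by simp
  then obtain v where v: "v \<in> carrier_vec n" and v0: "v \<noteq> 0\<^sub>v n" and ev: "A *\<^sub>v v = e \<cdot>\<^sub>v v"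
    using A unfolding eigenvalue_def eigenvector_def by auto
  obtain W c where W: "W \<in> carrier_mat n n" and WW: "transpose_mat W * W = 1\<^sub>m n"
    and col0: "col W 0 = c \<cdot>\<^sub>v v" by (rule orthonormal_extension[OF v v0])
  have WT: "transpose_mat W \<in> carrier_mat n n" using W by simp
  have WW': "W * transpose_mat W = 1\<^sub>m n" using mat_mult_left_right_inverse[OF WT W WW] .
  \<comment> \<open>In the basis \<open>W\<close> the matrix is symmetric with first column \<open>e\<close> times the first unit vector,
    hence block diagonal.\<close>
  define B where "B = transpose_mat W * A * W"
  have B: "B \<in> carrier_mat n n" using A W by (auto simp: B_def)
  have symB: "transpose_mat B = B" unfolding B_def using A W WT
    by (simp add: transpose_mult[of _ n n _ n] sym)
  have colW0: "col W 0 \<in> carrier_vec n" using W n by auto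
  have "col B 0 = (transpose_mat W * A) *\<^sub>v col W 0"
    unfolding B_def using n by (intro col_mult2[of _ n n _ n]) (use A W in auto)
  also have "\<dots> = transpose_mat W *\<^sub>v (A *\<^sub>v col W 0)"
    by (rule assoc_mult_mat_vec[OF WT A colW0])
  also have "A *\<^sub>v col W 0 = e \<cdot>\<^sub>v col W 0"
    unfolding col0 using A v ev by (simp add: mult_mat_vec smult_smult_assoc mult.commute)
  also have "transpose_mat W *\<^sub>v (e \<cdot>\<^sub>v col W 0) = e \<cdot>\<^sub>v (transpose_mat W *\<^sub>v col W 0)"
    using W by (intro mult_mat_vec[of _ n n]) auto
  also have "transpose_mat W *\<^sub>v col W 0 = col (1\<^sub>m n) 0"
    unfolding WW[symmetric] using W WT n by (subst col_mult2[of _ n n _ n]) auto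
  finally have colB: "col B 0 = e \<cdot>\<^sub>v unit_vec n 0" using n by simp
  have Bi0: "B $$ (i, 0) = (if i = 0 then e else 0)" if "i < n" for i
  proof -
    have "B $$ (i, 0) = vec_index (col B 0) i" using that n B by auto
    thus ?thesis unfolding colB using that n by simp
  qed
  have B0i: "B $$ (0, i) = (if i = 0 then e else 0)" if "i < n" for i
    using Bi0[OF that] symB that n B by (metis carrier_matD index_transpose_mat(1) neq0_conv)
  obtain A1 A2 A0 A3 where split: "split_block B 1 1 = (A1,A2,A0,A3)"
    by (cases "split_block B 1 1", auto)
  from B n have dims: "dim_row B = 1 + ?m" "dim_col B = 1 + ?m" by auto
  note sb = split_block[OF split dims]
  have A1: "A1 = mat 1 1 (\<lambda>_. e)" and A2: "A2 = 0\<^sub>m 1 ?m" and A0: "A0 = 0\<^sub>m ?m 1"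
    using split[unfolded split_block_def Let_def] B Bi0 B0i n by (auto intro!: eq_matI)
  have A3: "A3 \<in> carrier_mat ?m ?m" using sb by auto
  have A1c: "A1 \<in> carrier_mat 1 1" unfolding A1 by auto
  have Bb: "B = four_block_mat A1 (0\<^sub>m 1 ?m) (0\<^sub>m ?m 1) A3" using sb(5) A2 A0 by simp
  have A3e: "A3 $$ (i, j) = B $$ (Suc i, Suc j)" if "i < ?m" "j < ?m" for i j
    unfolding Bb using that A1c A3 by simp
  have symA3: "transpose_mat A3 = A3"
  proof (rule eq_matI)
    fix i j assume "i < dim_row A3" "j < dim_col A3"
    hence ij: "i < ?m" "j < ?m" using A3 by auto
    have "B $$ (Suc j, Suc i) = B $$ (Suc i, Suc j)" using symB B ij
      by (metis One_nat_def Suc_pred carrier_matD index_transpose_mat(1) n neq0_conv Suc_less_eq)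
    thus "transpose_mat A3 $$ (i, j) = A3 $$ (i, j)" using A3 A3e ij by simp
  qed (use A3 in auto)
  have "similar_mat B A" unfolding similar_mat_def
    by (intro exI[of _ "transpose_mat W"] exI[of _ W] similar_mat_witI[of _ _ n])
       (use A W WT B WW WW' B_def in auto)
  from cp char_poly_similar[OF this]
  have "char_poly B = [: -e,1 :] * (\<Prod> e \<leftarrow> es. [:- e, 1:])" by simp
  also have "char_poly B = char_poly A1 * char_poly A3"
    unfolding Bb by (rule char_poly_four_block_zeros_col[OF A1c _ A3]) auto
  also have "char_poly A1 = [: -e,1 :]"
    by (simp add: A1 char_poly_defs det_def sign_def)
  finally have cp3: "char_poly A3 = (\<Prod> e \<leftarrow> es. [:- e, 1:])"
    by (metis mult_cancel_left pCons_eq_0_iff zero_neq_one)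
  from Cons(1)[OF A3 symA3 cp3] obtain V where V: "V \<in> carrier_mat ?m ?m"
    and VV: "transpose_mat V * V = 1\<^sub>m ?m"
    and VA: "transpose_mat V * A3 * V = mat ?m ?m (\<lambda>(i, j). if i = j then es ! i else 0)" by auto
  define V' where "V' = four_block_mat (1\<^sub>m 1) (0\<^sub>m 1 ?m) (0\<^sub>m ?m 1) V"
  have V': "V' \<in> carrier_mat n n" unfolding V'_def using V n four_block_carrier_mat[of "1\<^sub>m 1" 1 1 V ?m ?m] by simp
  have V'T: "transpose_mat V' = four_block_mat (1\<^sub>m 1) (0\<^sub>m 1 ?m) (0\<^sub>m ?m 1) (transpose_mat V)"
    unfolding V'_def using V by (subst transpose_four_block_mat[of _ 1 1 _ ?m _ ?m]) auto
  have VT: "transpose_mat V \<in> carrier_mat ?m ?m" using V by simp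
  have V'V': "transpose_mat V' * V' = 1\<^sub>m n"
    unfolding V'T unfolding V'_def
    using V VV n
    by (subst mult_four_block_mat[of _ 1 1 _ ?m _ ?m _ _ 1 _ ?m]) (use four_block_one_mat[of 1 "n - 1"] in auto)
  have V'B: "transpose_mat V' * B * V' = mat n n (\<lambda>(i, j). if i = j then (e # es) ! i else 0)"
  proof -
    have "transpose_mat V' * B = four_block_mat A1 (0\<^sub>m 1 ?m) (0\<^sub>m ?m 1) (transpose_mat V * A3)"
      unfolding V'T Bb using VT A3 A1c
      by (subst mult_four_block_mat[of _ 1 1 _ ?m _ ?m _ _ 1 _ ?m]) auto
    also have "\<dots> * V' = four_block_mat A1 (0\<^sub>m 1 ?m) (0\<^sub>m ?m 1) (transpose_mat V * A3 * V)"
      unfolding V'_def using VT A3 A1c V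
      by (subst mult_four_block_mat[of _ 1 1 _ ?m _ ?m _ _ 1 _ ?m]) auto
    also have "\<dots> = mat n n (\<lambda>(i, j). if i = j then (e # es) ! i else 0)"
      unfolding VA A1 using n by (intro eq_matI) (auto simp: four_block_mat_def Let_def nth_Cons split: nat.splits)
    finally show ?thesis .
  qed
  have V'Tc: "transpose_mat V' \<in> carrier_mat n n" using V' by simp
  have WAc: "transpose_mat W * A \<in> carrier_mat n n" using WT A by simp
  show ?case
  proof (intro bexI[of _ "W * V'"] conjI)
    have tr: "transpose_mat (W * V') = transpose_mat V' * transpose_mat W"
      by (rule transpose_mult[OF W V'])
    have "transpose_mat (W * V') * (W * V') = transpose_mat V' * ((transpose_mat W * W) * V')"
      unfolding tr using assoc_mult_mat[OF V'Tc WT, of "W * V'" n] assoc_mult_mat[OF WT W V'] W V' by simp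
    thus "transpose_mat (W * V') * (W * V') = 1\<^sub>m n" using WW V'V' V' by simp
    have "transpose_mat (W * V') * A * (W * V') = transpose_mat V' * (transpose_mat W * A) * (W * V')"
      unfolding tr using assoc_mult_mat[OF V'Tc WT A] by simp
    also have "\<dots> = transpose_mat V' * ((transpose_mat W * A) * (W * V'))"
      by (rule assoc_mult_mat[OF V'Tc WAc]) (use W V' in auto)
    also have "(transpose_mat W * A) * (W * V') = B * V'"
      unfolding B_def by (rule assoc_mult_mat[OF WAc W V', symmetric])
    also have "transpose_mat V' * (B * V') = transpose_mat V' * B * V'"
      by (rule assoc_mult_mat[OF V'Tc B V', symmetric])
    finally show "transpose_mat (W * V') * A * (W * V') = mat n n (\<lambda>(i, j). if i = j then (e # es) ! i else 0)"
      using V'B by simp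
  qed (use W V' in simp)
qed

lemma scalar_prod_mult_mat_vec:
  fixes x :: rvec
  assumes U: "U \<in> carrier_mat d d" and x: "x \<in> carrier_vec d" and z: "z \<in> carrier_vec d"
  shows "scalar_prod x (U *\<^sub>v z) = (\<Sum>j<d. vec_index z j * scalar_prod x (col U j))"
proof -
  have "scalar_prod x (U *\<^sub>v z) = scalar_prod (transpose_mat U *\<^sub>v x) z"
    using transpose_vec_mult_scalar[OF U z x] by simp
  also have "\<dots> = (\<Sum>j<d. scalar_prod (col U j) x * vec_index z j)"
    using z U by (simp add: scalar_prod_def[of _ z] lessThan_atLeast0)
  also have "\<dots> = (\<Sum>j<d. vec_index z j * scalar_prod x (col U j))"
    using U x by (intro sum.cong refl) (simp add: comm_scalar_prod[of x d] mult.commute)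
  finally show ?thesis .
qed

text \<open>With \<open>A\<close> the identity this also expresses that an orthogonal \<open>U\<close> preserves norms.\<close>

lemma quadratic_form_diagonal:
  fixes U A :: rmat
  assumes U: "U \<in> carrier_mat d d" and A: "A \<in> carrier_mat d d" and z: "z \<in> carrier_vec d"
    and diag: "transpose_mat U * A * U = mat d d (\<lambda>(i, j). if i = j then l i else 0)"
  shows "scalar_prod (A *\<^sub>v (U *\<^sub>v z)) (U *\<^sub>v z) = (\<Sum>j<d. l j * (vec_index z j)\<^sup>2)"
proof -
  have UT: "transpose_mat U \<in> carrier_mat d d" using U by simp
  have Uz: "U *\<^sub>v z \<in> carrier_vec d" and AUz: "A *\<^sub>v (U *\<^sub>v z) \<in> carrier_vec d"
    using U A z by auto
  have "scalar_prod (A *\<^sub>v (U *\<^sub>v z)) (U *\<^sub>v z) = scalar_prod (transpose_mat U *\<^sub>v (A *\<^sub>v (U *\<^sub>v z))) z"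
    using transpose_vec_mult_scalar[OF U z AUz] by simp
  also have "transpose_mat U *\<^sub>v (A *\<^sub>v (U *\<^sub>v z)) = (transpose_mat U * A * U) *\<^sub>v z"
    using assoc_mult_mat_vec[OF UT A Uz] assoc_mult_mat_vec[of "transpose_mat U * A" d d U d z] UT A U z by simp
  also have "\<dots> = vec d (\<lambda>i. l i * vec_index z i)"
    unfolding diag using z
    by (intro eq_vecI) (auto simp: scalar_prod_def if_distrib[of "\<lambda>x. x * _"] sum.delta cong: if_cong)
  also have "scalar_prod \<dots> z = (\<Sum>j<d. l j * (vec_index z j)\<^sup>2)"
    using z by (simp add: scalar_prod_def lessThan_atLeast0 power2_eq_square mult_ac)
  finally show ?thesis .
qed

section \<open>Lower tail of weighted squares of a Gaussian family\<close>

lemma std_normal_exp_square: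
  fixes a :: real
  assumes "a \<ge> 0"
  shows "integrable std_normal_distribution (\<lambda>x. exp (- a * x\<^sup>2))"
    and "(\<integral>x. exp (- a * x\<^sup>2) \<partial>std_normal_distribution) = 1 / sqrt (1 + 2 * a)"
proof -
  define s where "s = 1 / sqrt (1 + 2 * a)"
  have s: "s > 0" using assms by (simp add: s_def)
  have s2: "s\<^sup>2 = 1 / (1 + 2 * a)" using assms by (simp add: s_def power_divide)
  have eq: "std_normal_density x *\<^sub>R exp (- a * x\<^sup>2) = s * normal_density 0 s x" for x
  proof -
    have "- x\<^sup>2 / 2 + - a * x\<^sup>2 = - x\<^sup>2 / (2 * s\<^sup>2)"
      unfolding s2 using assms by (simp add: field_simps)
    hence "exp (- x\<^sup>2 / 2) * exp (- a * x\<^sup>2) = exp (- x\<^sup>2 / (2 * s\<^sup>2))"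
      by (metis exp_add)
    moreover have "s / sqrt (2 * pi * s\<^sup>2) = 1 / sqrt (2 * pi)"
      using s by (simp add: real_sqrt_mult)
    ultimately show ?thesis
      unfolding normal_density_def by (simp add: field_simps)
  qed
  have int: "integrable lborel (\<lambda>x. s * normal_density 0 s x)"
    using integrable_normal_density[OF s] by simp
  show "integrable std_normal_distribution (\<lambda>x. exp (- a * x\<^sup>2))"
    by (subst integrable_density) (use int eq in auto)
  have "(\<integral>x. exp (- a * x\<^sup>2) \<partial>std_normal_distribution) = (\<integral>x. s * normal_density 0 s x \<partial>lborel)"
    by (subst integral_density) (auto simp: eq[symmetric])
  also have "\<dots> = s" using integral_normal_density[OF s] by simp
  finally show "(\<integral>x. exp (- a * x\<^sup>2) \<partial>std_normal_distribution) = 1 / sqrt (1 + 2 * a)"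
    by (simp add: s_def)
qed

text \<open>The hypothesis on the characteristic function says that \<open>Y\<close> is a centred Gaussian family with
  independent coordinates of variance \<open>\<nu> i\<close>, possibly zero.\<close>

lemma (in prob_space) laplace_transform_gaussian_squares:
  fixes Y :: "'i \<Rightarrow> 'a \<Rightarrow> real" and \<nu> c :: "'i \<Rightarrow> real"
  assumes I: "finite I"
    and Y [measurable]: "\<And>i. i \<in> I \<Longrightarrow> Y i \<in> borel_measurable M"
    and char: "\<And>a. (CLINT \<omega>|M. iexp (\<Sum>i\<in>I. a i * Y i \<omega>)) = of_real (exp (- (\<Sum>i\<in>I. \<nu> i * (a i)\<^sup>2) / 2))"
    and \<nu>: "\<And>i. i \<in> I \<Longrightarrow> \<nu> i \<ge> 0" and c: "\<And>i. i \<in> I \<Longrightarrow> c i \<ge> 0"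
  shows "expectation (\<lambda>\<omega>. exp (- (\<Sum>i\<in>I. c i * (Y i \<omega>)\<^sup>2))) = (\<Prod>i\<in>I. 1 / sqrt (1 + 2 * (c i * \<nu> i)))"
proof -
  interpret std: real_distribution std_normal_distribution by (rule real_dist_normal_dist)
  interpret P: finite_product_prob_space "\<lambda>i. std_normal_distribution" I
    by unfold_locales (rule I)
  define H where "H = Pi\<^sub>M I (\<lambda>i. std_normal_distribution)"
  interpret H: prob_space H unfolding H_def by (rule P.prob_space_axioms)
  interpret MH: pair_prob_space M H ..
  define b where "b i = sqrt (2 * c i)" for i
  have b2: "(b i)\<^sup>2 = 2 * c i" if "i \<in> I" for i using c[OF that] by (simp add: b_def)
  have Hm [measurable]: "(\<lambda>h. h i) \<in> borel_measurable H" if "i \<in> I" for i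
    using measurable_component_singleton[OF that, of "\<lambda>_. std_normal_distribution"]
    unfolding H_def by (simp cong: measurable_cong_sets)
  define f where "f \<omega> h = iexp (\<Sum>i\<in>I. (b i * h i) * Y i \<omega>)" for \<omega> h
  \<comment> \<open>\<open>exp (- x\<^sup>2 / 2)\<close> is the characteristic function of the standard normal law at \<open>x\<close>.\<close>
  have step1: "of_real (exp (- (\<Sum>i\<in>I. c i * (Y i \<omega>)\<^sup>2))) = (CLINT h|H. f \<omega> h)" for \<omega>
  proof -
    have "complex_of_real (exp (- (\<Sum>i\<in>I. c i * (Y i \<omega>)\<^sup>2)))
        = (\<Prod>i\<in>I. of_real (exp (- ((b i * Y i \<omega>)\<^sup>2) / 2)))"
      by (simp add: exp_sum[OF I] sum_negf[symmetric] b2 power_mult_distrib)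
    also have "\<dots> = (\<Prod>i\<in>I. CLINT x|std_normal_distribution. iexp (b i * Y i \<omega> * x))"
    proof (intro prod.cong refl)
      fix i
      show "of_real (exp (- ((b i * Y i \<omega>)\<^sup>2) / 2)) = (CLINT x|std_normal_distribution. iexp (b i * Y i \<omega> * x))"
        using fun_cong[OF char_std_normal_distribution, of "b i * Y i \<omega>"] unfolding char_def by simp
    qed
    also have "\<dots> = (CLINT h|H. \<Prod>i\<in>I. iexp (b i * Y i \<omega> * h i))"
      unfolding H_def by (rule P.product_integral_prod[symmetric, OF I]) (rule std.integrable_iexp; simp)
    also have "\<dots> = (CLINT h|H. f \<omega> h)"
      by (simp add: f_def exp_sum[OF I] sum_distrib_left mult_ac)
    finally show ?thesis .
  qed
  have fm [measurable]: "case_prod f \<in> borel_measurable (M \<Otimes>\<^sub>M H)"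
    unfolding f_def by measurable
  have int: "integrable (M \<Otimes>\<^sub>M H) (case_prod f)"
    by (rule MH.integrable_const_bound[of _ 1]) (auto simp: f_def)
  have "complex_of_real (expectation (\<lambda>\<omega>. exp (- (\<Sum>i\<in>I. c i * (Y i \<omega>)\<^sup>2))))
      = (CLINT \<omega>|M. (CLINT h|H. f \<omega> h))"
    by (simp add: step1[symmetric])
  also have "\<dots> = (CLINT h|H. (CLINT \<omega>|M. f \<omega> h))"
    by (rule MH.Fubini_integral[OF int, symmetric])
  also have "\<dots> = (CLINT h|H. of_real (\<Prod>i\<in>I. exp (- (c i * \<nu> i) * (h i)\<^sup>2)))"
  proof (rule arg_cong[of _ _ "integral\<^sup>L H"], rule ext)
    fix h
    have "(\<Sum>i\<in>I. \<nu> i * (b i * h i)\<^sup>2) / 2 = (\<Sum>i\<in>I. c i * \<nu> i * (h i)\<^sup>2)"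
      by (simp add: sum_divide_distrib power_mult_distrib b2 mult_ac)
    thus "(CLINT \<omega>|M. f \<omega> h) = of_real (\<Prod>i\<in>I. exp (- (c i * \<nu> i) * (h i)\<^sup>2))"
      using char[of "\<lambda>i. b i * h i"] by (simp add: f_def exp_sum[OF I, symmetric] sum_negf)
  qed
  also have "\<dots> = of_real (\<integral>h. (\<Prod>i\<in>I. exp (- (c i * \<nu> i) * (h i)\<^sup>2)) \<partial>H)" by (rule integral_complex_of_real)
  also have "(\<integral>h. (\<Prod>i\<in>I. exp (- (c i * \<nu> i) * (h i)\<^sup>2)) \<partial>H)
     = (\<Prod>i\<in>I. \<integral>x. exp (- (c i * \<nu> i) * x\<^sup>2) \<partial>std_normal_distribution)"
    unfolding H_def by (rule P.product_integral_prod[OF I]) (intro std_normal_exp_square(1) mult_nonneg_nonneg c \<nu>)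
  also have "\<dots> = (\<Prod>i\<in>I. 1 / sqrt (1 + 2 * (c i * \<nu> i)))"
    by (intro prod.cong refl std_normal_exp_square(2) mult_nonneg_nonneg c \<nu>)
  finally show ?thesis using of_real_eq_iff by blast
qed

text \<open>Convexity of the exponential reduces the factors of the Laplace transform with weight \<open>p\<close>
  in $[0,1]$ to powers of the factor with weight 1.\<close>

lemma two_powr_le_sqrt:
  fixes p :: real
  assumes "0 \<le> p" "p \<le> 1"
  shows "2 powr p \<le> sqrt (1 + 3 * p)"
proof -
  have "exp ((1 - p) * 0 + p * ln 4) \<le> (1 - p) * exp 0 + p * exp (ln (4::real))"
    using convex_onD[OF exp_convex, of p 0 "ln 4"] assms by simp
  hence "4 powr p \<le> 1 + 3 * p" by (simp add: powr_def algebra_simps)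
  moreover have "(2 powr p)\<^sup>2 = 4 powr p"
    by (simp add: powr_power[symmetric] power2_eq_square powr_mult[symmetric])
  ultimately show ?thesis by (intro real_le_rsqrt) simp
qed

lemma (in prob_space) gaussian_squares_lower_tail:
  fixes Y :: "'i \<Rightarrow> 'a \<Rightarrow> real" and \<nu> c :: "'i \<Rightarrow> real"
  assumes I: "finite I"
    and Y [measurable]: "\<And>i. i \<in> I \<Longrightarrow> Y i \<in> borel_measurable M"
    and char: "\<And>a. (CLINT \<omega>|M. iexp (\<Sum>i\<in>I. a i * Y i \<omega>)) = of_real (exp (- (\<Sum>i\<in>I. \<nu> i * (a i)\<^sup>2) / 2))"
    and \<nu>: "\<And>i. i \<in> I \<Longrightarrow> \<nu> i \<ge> 0" and c: "\<And>i. i \<in> I \<Longrightarrow> c i \<ge> 0"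
    and p: "\<And>i. i \<in> I \<Longrightarrow> c i * \<nu> i \<le> 1" and P: "3 \<le> (\<Sum>i\<in>I. c i * \<nu> i)"
  shows "prob {\<omega>\<in>space M. (\<Sum>i\<in>I. c i * (Y i \<omega>)\<^sup>2) \<le> (\<Sum>i\<in>I. c i * \<nu> i) / 4} < 1 / 2"
proof -
  define P where "P = (\<Sum>i\<in>I. c i * \<nu> i)"
  define Q where "Q \<omega> = (\<Sum>i\<in>I. c i * (Y i \<omega>)\<^sup>2)" for \<omega>
  \<comment> \<open>The exponent \<open>3 / 2\<close> makes the factor \<open>1 + 2 s\<close> equal to 4, which is optimal for the threshold
    \<open>P / 4\<close> when all \<open>c i * \<nu> i\<close> are 1.\<close>
  define Z where "Z \<omega> = exp (- (\<Sum>i\<in>I. 3 / 2 * c i * (Y i \<omega>)\<^sup>2))" for \<omega>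
  have Zm [measurable]: "Z \<in> borel_measurable M" unfolding Z_def by measurable
  have ZQ: "Z \<omega> = exp (- (3 / 2) * Q \<omega>)" for \<omega>
    by (simp add: Z_def Q_def sum_distrib_left sum_negf[symmetric] mult_ac)
  have Q0: "Q \<omega> \<ge> 0" for \<omega> unfolding Q_def by (intro sum_nonneg mult_nonneg_nonneg c) auto
  have Zint: "integrable M Z"
    by (rule integrable_const_bound[of _ 1]) (use Q0 in \<open>auto simp: ZQ\<close>)
  have "expectation Z = (\<Prod>i\<in>I. 1 / sqrt (1 + 2 * (3 / 2 * c i * \<nu> i)))"
    unfolding Z_def by (rule laplace_transform_gaussian_squares[OF I Y char \<nu>]) (use c in auto)
  also have "\<dots> \<le> (\<Prod>i\<in>I. 1 / 2 powr (c i * \<nu> i))"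
  proof (intro prod_mono conjI)
    fix i assume i: "i \<in> I"
    have "2 powr (c i * \<nu> i) \<le> sqrt (1 + 3 * (c i * \<nu> i))"
      by (rule two_powr_le_sqrt) (use i c \<nu> p in auto)
    thus "1 / sqrt (1 + 2 * (3 / 2 * c i * \<nu> i)) \<le> 1 / 2 powr (c i * \<nu> i)"
      using frac_le[of 1 1 "2 powr (c i * \<nu> i)" "sqrt (1 + 3 * (c i * \<nu> i))"] by (simp add: mult.assoc mult.commute[of "\<nu> i"])
    show "0 \<le> 1 / sqrt (1 + 2 * (3 / 2 * c i * \<nu> i))" using c[OF i] \<nu>[OF i] by simp
  qed
  also have "\<dots> = exp (- ln 2 * P)"
    by (simp add: P_def powr_def exp_sum[OF I] exp_minus sum_distrib_left inverse_eq_divide mult_ac prod_dividef[symmetric])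
  finally have EZ: "expectation Z \<le> exp (- ln 2 * P)" .
  have "{\<omega>\<in>space M. Q \<omega> \<le> P / 4} \<subseteq> {\<omega>\<in>space M. Z \<omega> \<ge> exp (- (3 / 8) * P)}"
    by (auto simp: ZQ)
  hence "prob {\<omega>\<in>space M. Q \<omega> \<le> P / 4} \<le> prob {\<omega>\<in>space M. Z \<omega> \<ge> exp (- (3 / 8) * P)}"
    by (intro finite_measure_mono) measurable
  also have "\<dots> \<le> expectation Z / exp (- (3 / 8) * P)"
    by (rule integral_Markov_inequality_measure[where A = "{}", OF Zint]) (auto simp: ZQ)
  also have "\<dots> \<le> exp (- ln 2 * P) / exp (- (3 / 8) * P)"
    by (intro divide_right_mono EZ) simp
  also have "\<dots> = exp (- (ln 2 - 3 / 8) * P)" by (simp add: exp_diff[symmetric] algebra_simps)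
  also have "\<dots> \<le> exp (- (ln 2 - 3 / 8) * 3)"
  proof -
    have "(ln 2 - 3 / 8) * 3 \<le> (ln 2 - 3 / 8) * P"
      using P ln2_ge_two_thirds unfolding P_def by (intro mult_left_mono) auto
    thus ?thesis by (simp only: exp_le_cancel_iff mult_minus_left neg_le_iff_le)
  qed
  also have "\<dots> < exp (- ln 2)" using ln2_ge_two_thirds by simp
  also have "\<dots> = 1 / 2" by (simp add: exp_minus)
  finally show ?thesis unfolding Q_def P_def .
qed


section \<open>The lower bound in coordinates\<close>

text \<open>A deterministic statement: \<open>y\<close> and \<open>w\<close> are the coordinates of the deviation of the mean and of
  the direction in the eigenbasis.\<close>

lemma ellipsoid_test_direction:
  fixes I :: "'i set" and y \<nu> :: "'i \<Rightarrow> real" and C L S \<theta> :: real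
  defines "c \<equiv> \<lambda>i. 1 / max (\<nu> i) \<theta>"
  defines "Q \<equiv> \<Sum>i\<in>I. c i * (y i)\<^sup>2"
  assumes I: "finite I" and \<nu>: "\<And>i. i \<in> I \<Longrightarrow> \<nu> i \<ge> 0" and \<theta>: "\<theta> > 0" and C: "C \<ge> 0" and L: "L \<ge> 0"
    and le: "\<And>w. (\<Sum>i\<in>I. (w i)\<^sup>2) = 1 \<Longrightarrow>
       (\<Sum>i\<in>I. w i * y i) \<le> C * sqrt ((\<Sum>i\<in>I. \<nu> i * (w i)\<^sup>2) * L) + S"
    and Q: "Q > 0" and CQ: "C * sqrt L \<le> sqrt Q"
  shows "sqrt \<theta> * (sqrt Q - C * sqrt L) \<le> S"
proof -
  have c: "c i > 0" "c i * \<theta> \<le> 1" "c i * \<nu> i \<le> 1" for i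
    using \<theta> by (auto simp: c_def divide_le_eq)
  define n where "n = (\<Sum>i\<in>I. (c i * y i)\<^sup>2)"
  have "\<theta> * n = (\<Sum>i\<in>I. (c i * \<theta>) * (c i * (y i)\<^sup>2))"
    by (simp add: n_def sum_distrib_left power2_eq_square mult_ac)
  also have "\<dots> \<le> Q" unfolding Q_def
    by (intro sum_mono mult_left_le_one_le mult_nonneg_nonneg less_imp_le[OF c(1)] c(2)) (use \<theta> in auto)
  finally have nQ: "\<theta> * n \<le> Q" .
  have "n \<noteq> 0"
  proof
    assume "n = 0"
    hence "\<forall>i\<in>I. (c i * y i)\<^sup>2 = 0" unfolding n_def by (subst (asm) sum_nonneg_eq_0_iff[OF I]) auto
    hence "\<forall>i\<in>I. y i = 0" using c(1) by (metis mult_eq_0_iff less_irrefl zero_eq_power2)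
    thus False using Q by (simp add: Q_def)
  qed
  moreover have "n \<ge> 0" unfolding n_def by (intro sum_nonneg) auto
  ultimately have n: "n > 0" by simp
  define w where "w i = c i * y i / sqrt n" for i
  have w1: "(\<Sum>i\<in>I. (w i)\<^sup>2) = 1"
    using n by (simp add: w_def power_divide sum_divide_distrib[symmetric] n_def[symmetric])
  have wy: "(\<Sum>i\<in>I. w i * y i) = Q / sqrt n"
    by (simp add: w_def Q_def sum_divide_distrib power2_eq_square mult_ac)
  have "(\<Sum>i\<in>I. \<nu> i * (w i)\<^sup>2) = (\<Sum>i\<in>I. (c i * \<nu> i) * (c i * (y i)\<^sup>2)) / n"
    using n by (simp add: w_def power_divide sum_divide_distrib power2_eq_square mult_ac)
  also have "\<dots> \<le> Q / n" unfolding Q_def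
    by (intro divide_right_mono sum_mono mult_left_le_one_le mult_nonneg_nonneg less_imp_le[OF c(1)] c(3) \<nu>)
       (use n in auto)
  finally have var: "(\<Sum>i\<in>I. \<nu> i * (w i)\<^sup>2) \<le> Q / n" .
  have "Q / sqrt n \<le> C * sqrt ((\<Sum>i\<in>I. \<nu> i * (w i)\<^sup>2) * L) + S" using le[OF w1] wy by simp
  also have "C * sqrt ((\<Sum>i\<in>I. \<nu> i * (w i)\<^sup>2) * L) \<le> C * sqrt (Q / n * L)"
    by (intro mult_left_mono real_sqrt_le_mono mult_right_mono var C L)
  finally have "Q / sqrt n - C * sqrt (Q / n * L) \<le> S" by simp
  moreover have "Q / sqrt n - C * sqrt (Q / n * L) = sqrt (Q / n) * (sqrt Q - C * sqrt L)"
  proof -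
    have "Q / sqrt n = sqrt (Q / n) * sqrt Q" using Q by (simp add: real_sqrt_divide)
    thus ?thesis using Q by (simp only: real_sqrt_mult) (simp add: algebra_simps)
  qed
  moreover have "sqrt \<theta> \<le> sqrt (Q / n)" using nQ n by (simp add: pos_le_divide_eq)
  hence "sqrt \<theta> * (sqrt Q - C * sqrt L) \<le> sqrt (Q / n) * (sqrt Q - C * sqrt L)"
    using CQ by (intro mult_right_mono) auto
  ultimately show ?thesis by linarith
qed

lemma (in prob_space) gaussian_strong_term_lower_bound:
  fixes Y :: "nat \<Rightarrow> 'a \<Rightarrow> real" and \<nu> :: "nat \<Rightarrow> real" and C L S :: real
  assumes Y [measurable]: "\<And>i. i \<in> {1..d} \<Longrightarrow> Y i \<in> borel_measurable M"
    and char: "\<And>a. (CLINT \<omega>|M. iexp (\<Sum>i\<in>{1..d}. a i * Y i \<omega>)) = of_real (exp (- (\<Sum>i\<in>{1..d}. \<nu> i * (a i)\<^sup>2) / 2))"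
    and \<nu>: "\<And>i. i \<in> {1..d} \<Longrightarrow> \<nu> i \<ge> 0"
    and dec: "\<And>i j. 1 \<le> i \<Longrightarrow> i \<le> j \<Longrightarrow> j \<le> d \<Longrightarrow> \<nu> j \<le> \<nu> i"
    and C: "C > 0" and L: "L \<ge> ln 2"
    and k: "k = 1 + (2 * C + sqrt 2)\<^sup>2 * L" "k < real d"
    and E: "E \<in> sets M" "prob E \<ge> 1 / 2"
    and le: "\<And>\<omega> w. \<omega> \<in> E \<Longrightarrow> (\<Sum>i\<in>{1..d}. (w i)\<^sup>2) = 1 \<Longrightarrow>
       (\<Sum>i\<in>{1..d}. w i * Y i \<omega>) \<le> C * sqrt ((\<Sum>i\<in>{1..d}. \<nu> i * (w i)\<^sup>2) * L) + S"
  shows "1 / (2 * (sqrt 2 * C + 1)) * sqrt (\<Sum>i \<in> {i \<in> {1..d}. k < real i}. \<nu> i) \<le> S"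
proof -
  define m where "m = nat \<lfloor>k\<rfloor> + 1"
  have L0: "L \<ge> 2 / 3" using L ln2_ge_two_thirds by linarith
  have "(sqrt 2)\<^sup>2 \<le> (2 * C + sqrt 2)\<^sup>2" using C by (intro power_mono) auto
  hence "2 * (2 / 3) \<le> (2 * C + sqrt 2)\<^sup>2 * L" using L0 by (intro mult_mono) auto
  hence k2: "k > 2" using k(1) by simp
  have mk: "k < real m" and km: "real m \<le> k + 1" unfolding m_def using k2 by linarith+
  have m3: "3 \<le> m" using mk k2 by linarith
  have md: "m \<le> d" using km k(2) by linarith
  have mI: "m \<in> {1..d}" using m3 md by simp
  have tail: "{i \<in> {1..d}. k < real i} = {m..d}"
  proof -
    have "k < real i \<longleftrightarrow> m \<le> i" for i
    proof
      assume "k < real i" hence "real m < real (i + 1)" using km by simp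
      thus "m \<le> i" by linarith
    next
      assume "m \<le> i" hence "real m \<le> real i" by simp
      thus "k < real i" using mk by linarith
    qed
    thus ?thesis using m3 by (auto simp: set_eq_iff)
  qed
  define \<theta> where "\<theta> = \<nu> m"
  have \<theta>0: "\<theta> \<ge> 0" using \<nu>[OF mI] by (simp add: \<theta>_def)
  have Ene: "prob E > 0" using E(2) by linarith
  show ?thesis
  proof (cases "\<theta> = 0")
    case True
    have z: "(\<Sum>i\<in>{m..d}. \<nu> i) = 0"
      using dec[of m] \<nu> m3 True by (intro sum.neutral) (force simp: \<theta>_def intro!: antisym)
    \<comment> \<open>Both signs of the \<open>m\<close>-th basis vector are directions of variance zero.\<close>
    from Ene obtain \<omega> where \<omega>: "\<omega> \<in> E" by (cases "E = {}") auto
    define w where "w s i = (if i = m then s else 0 :: real)" for s :: real and i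
    have "s * Y m \<omega> \<le> S" if s: "s\<^sup>2 = 1" for s
    proof -
      have "(\<Sum>i\<in>{1..d}. (w s i)\<^sup>2) = s\<^sup>2" "(\<Sum>i\<in>{1..d}. w s i * Y i \<omega>) = s * Y m \<omega>"
        "(\<Sum>i\<in>{1..d}. \<nu> i * (w s i)\<^sup>2) = 0"
        using mI True by (auto simp: w_def \<theta>_def if_distrib[of "\<lambda>x. x\<^sup>2"] if_distrib[of "\<lambda>x. x * _"]
             if_distrib[of "(*) _"] cong: if_cong intro!: sum.neutral)
      thus ?thesis using le[OF \<omega>, of "w s"] s by simp
    qed
    from this[of 1] this[of "-1"] have "S \<ge> 0" by simp
    thus ?thesis unfolding tail z by simp
  next
    case False
    hence \<theta>: "\<theta> > 0" using \<theta>0 by simp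
    define c where "c i = 1 / max (\<nu> i) \<theta>" for i
    define Q where "Q \<omega> = (\<Sum>i\<in>{1..d}. c i * (Y i \<omega>)\<^sup>2)" for \<omega>
    define P where "P = (\<Sum>i\<in>{1..d}. c i * \<nu> i)"
    have c: "c i \<ge> 0" "c i * \<nu> i \<le> 1" for i using \<theta> by (auto simp: c_def field_simps)
    have head: "c i * \<nu> i = 1" if "i \<in> {1..m}" for i
      using dec[of i m] that md \<theta> by (auto simp: c_def \<theta>_def max_def)
    have tl: "\<theta> * (c i * \<nu> i) = \<nu> i" if "i \<in> {m..d}" for i
      using dec[of m i] that m3 \<theta> by (auto simp: c_def \<theta>_def max_def)
    have "real m = (\<Sum>i\<in>{1..m}. c i * \<nu> i)" using head by simp
    also have "\<dots> \<le> P" unfolding P_def using md c \<nu> by (intro sum_mono2) auto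
    finally have mP: "real m \<le> P" .
    have "(\<Sum>i\<in>{m..d}. \<nu> i) = \<theta> * (\<Sum>i\<in>{m..d}. c i * \<nu> i)" unfolding sum_distrib_left by (rule sum.cong) (use tl in auto)
    also have "\<dots> \<le> \<theta> * P" unfolding P_def using m3 c \<nu> \<theta> by (intro mult_left_mono sum_mono2) auto
    finally have sP: "(\<Sum>i\<in>{m..d}. \<nu> i) \<le> \<theta> * P" .
    have "prob {\<omega>\<in>space M. Q \<omega> \<le> P / 4} < 1 / 2"
      unfolding Q_def P_def by (rule gaussian_squares_lower_tail[OF _ Y char \<nu> c])
        (use mP m3 in \<open>auto simp: P_def\<close>)
    hence "prob {\<omega>\<in>space M. Q \<omega> \<le> P / 4} < prob E" using E(2) by linarith
    hence "\<not> E \<subseteq> {\<omega>\<in>space M. Q \<omega> \<le> P / 4}"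
      using finite_measure_mono[of E "{\<omega>\<in>space M. Q \<omega> \<le> P / 4}"] by (force simp: Q_def)
    then obtain \<omega> where \<omega>: "\<omega> \<in> E" "Q \<omega> > P / 4"
      using sets.sets_into_space[OF E(1)] by force
    define q where "q = sqrt (Q \<omega>)"
    have "(sqrt P / 2)\<^sup>2 \<le> Q \<omega>" using \<omega>(2) mP by (simp add: power_divide)
    hence qP: "sqrt P / 2 \<le> q" unfolding q_def by (rule real_le_rsqrt)
    \<comment> \<open>Here the size of \<open>k\<close> enters: \<open>C * sqrt L\<close> is only a fraction of \<open>q\<close>.\<close>
    have "((2 * C + sqrt 2) * sqrt L)\<^sup>2 \<le> P"
      using mP mk k(1) L0 by (simp add: power_mult_distrib)
    hence "(2 * C + sqrt 2) * sqrt L \<le> sqrt P" by (rule real_le_rsqrt)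
    hence "(2 * C + sqrt 2) * sqrt L \<le> 2 * q" using qP by linarith
    hence "sqrt 2 * ((2 * C + sqrt 2) * sqrt L) \<le> sqrt 2 * (2 * q)" by (rule mult_left_mono) simp
    hence Lq: "(sqrt 2 * C + 1) * sqrt L \<le> sqrt 2 * q" by (simp add: algebra_simps)
    have D: "sqrt 2 * C + 1 > 0" using C by (simp add: add_pos_pos)
    have "C * ((sqrt 2 * C + 1) * sqrt L) \<le> C * (sqrt 2 * q)" by (rule mult_left_mono[OF Lq]) (use C in simp)
    hence gap: "q / (sqrt 2 * C + 1) \<le> q - C * sqrt L"
      using D by (simp add: field_simps)
    have q0: "q > 0" unfolding q_def using \<omega>(2) mP by simp
    have "1 / (2 * (sqrt 2 * C + 1)) * sqrt (\<Sum>i\<in>{m..d}. \<nu> i) \<le> 1 / (2 * (sqrt 2 * C + 1)) * sqrt (\<theta> * P)"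
      by (intro mult_left_mono real_sqrt_le_mono sP) (use D in simp)
    also have "\<dots> = sqrt \<theta> * ((sqrt P / 2) / (sqrt 2 * C + 1))" by (simp add: real_sqrt_mult)
    also have "\<dots> \<le> sqrt \<theta> * (q / (sqrt 2 * C + 1))"
      by (intro mult_left_mono divide_right_mono qP) (use D \<theta> in auto)
    also have "\<dots> \<le> sqrt \<theta> * (q - C * sqrt L)" by (intro mult_left_mono gap) (use \<theta> in auto)
    also have "\<dots> \<le> S"
      unfolding q_def Q_def c_def
    proof (rule ellipsoid_test_direction[OF _ \<nu> \<theta> _ _ le[OF \<omega>(1)]])
      show "0 < (\<Sum>i = 1..d. 1 / max (\<nu> i) \<theta> * (Y i \<omega>)\<^sup>2)"
        using \<omega>(2) mP by (simp add: Q_def c_def)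
      have "0 \<le> q / (sqrt 2 * C + 1)" using q0 D by simp
      thus "C * sqrt L \<le> sqrt (\<Sum>i = 1..d. 1 / max (\<nu> i) \<theta> * (Y i \<omega>)\<^sup>2)"
        using gap by (simp add: q_def Q_def c_def)
    qed (use C L0 in auto)
    finally show ?thesis unfolding tail .
  qed
qed

section \<open>The law of the empirical mean\<close>

lemma (in prob_space) normal_law_moments:
  fixes Z :: "'a \<Rightarrow> real"
  assumes Z [measurable]: "Z \<in> borel_measurable M" and s: "0 \<le> s"
    and distr: "distr M borel Z = normal_law m s"
  shows "expectation Z = m" and "variance Z = s\<^sup>2"
    and "(CLINT \<omega>|M. iexp (t * (Z \<omega> - m))) = of_real (exp (- (s\<^sup>2 * t\<^sup>2) / 2))"
proof -
  have "expectation Z = m \<and> variance Z = s\<^sup>2 \<and>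
    (CLINT \<omega>|M. iexp (t * (Z \<omega> - m))) = of_real (exp (- (s\<^sup>2 * t\<^sup>2) / 2))"
  proof (cases "s = 0")
    case True
    have "AE x in distr M borel Z. x = m"
      unfolding distr normal_law_def if_P[OF True] by (subst AE_return) auto
    hence ae: "AE \<omega> in M. Z \<omega> = m" by (subst (asm) AE_distr_iff) auto
    have e: "expectation Z = m"
      using integral_cong_AE[OF _ _ ae] by (simp add: prob_space)
    moreover have "variance Z = 0"
      using integral_cong_AE[of "\<lambda>\<omega>. (Z \<omega> - expectation Z)\<^sup>2" M "\<lambda>_. 0"] ae e by auto
    moreover have "(CLINT \<omega>|M. iexp (t * (Z \<omega> - m))) = (CLINT \<omega>|M. 1)"
      by (rule integral_cong_AE) (use ae in auto)
    ultimately show ?thesis using True by (simp add: prob_space)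
  next
    case False
    with s have s0: "s > 0" by simp
    have D: "distributed M lborel Z (normal_density m s)"
      unfolding distributed_def
      using distr s0 by (simp add: normal_law_def distr_cong[OF refl sets_lborel])
    hence D': "distributed M lborel (\<lambda>\<omega>. (Z \<omega> - m) / s) std_normal_density"
      using normal_standard_normal_convert[OF s0] by blast
    have m': "(\<lambda>\<omega>. (Z \<omega> - m) / s) \<in> borel_measurable M" by measurable
    have std: "distr M borel (\<lambda>\<omega>. (Z \<omega> - m) / s) = std_normal_distribution"
      using distributed_distr_eq_density[OF D'] by (simp add: distr_cong[OF refl sets_lborel])
    have "(CLINT \<omega>|M. iexp (t * (Z \<omega> - m))) = (CLINT \<omega>|M. iexp ((t * s) * ((Z \<omega> - m) / s)))"
      using s0 by simp
    also have "\<dots> = char (distr M borel (\<lambda>\<omega>. (Z \<omega> - m) / s)) (t * s)"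
      unfolding char_def by (subst integral_distr) auto
    also have "\<dots> = of_real (exp (- (s\<^sup>2 * t\<^sup>2) / 2))"
      unfolding std using fun_cong[OF char_std_normal_distribution, of "t * s"]
      by (simp add: power_mult_distrib mult.commute)
    finally show ?thesis
      using normal_distributed_expectation[OF s0 D] normal_distributed_variance[OF s0 D] by simp
  qed
  thus "expectation Z = m" "variance Z = s\<^sup>2"
    "(CLINT \<omega>|M. iexp (t * (Z \<omega> - m))) = of_real (exp (- (s\<^sup>2 * t\<^sup>2) / 2))" by auto
qed

lemma measurable_borel_vec_component [measurable]:
  assumes "i < d"
  shows "(\<lambda>x. vec_index x i) \<in> borel_measurable (borel_vec d)"
proof -
  let ?f = "\<lambda>v::rvec. \<lambda>i\<in>{..<d}. vec_index v i"
  have "?f \<in> measurable (borel_vec d) (\<Pi>\<^sub>M i\<in>{..<d}. borel)"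
    unfolding borel_vec_def by (rule measurable_vimage_algebra1) (auto simp: space_PiM)
  moreover have "(\<lambda>g. g i) \<in> measurable (\<Pi>\<^sub>M i\<in>{..<d}. (borel :: real measure)) borel"
    by (rule measurable_component_singleton) (use assms in simp)
  ultimately have "(\<lambda>x. ?f x i) \<in> borel_measurable (borel_vec d)"
    by (rule measurable_compose)
  thus ?thesis using assms by simp
qed

lemma space_borel_vec: "space (borel_vec d) = carrier_vec d"
  by (simp add: borel_vec_def)

lemma measurable_borel_vec_scalar_prod:
  assumes "v \<in> carrier_vec d"
  shows "(\<lambda>x. scalar_prod x v) \<in> borel_measurable (borel_vec d)"
  using assms unfolding scalar_prod_def by (intro borel_measurable_sum borel_measurable_times) auto

text \<open>The parameters of the normal law of a projection are identified from the mean vector and the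
  covariance matrix.\<close>

lemma (in prob_space) gaussian_vector_projection:
  assumes G: "gaussian_vector M d X" and mean: "has_mean M d X \<mu>" and cov: "has_covariance M d X A"
    and v: "v \<in> carrier_vec d"
  shows "(CLINT \<omega>|M. iexp (t * (scalar_prod (X \<omega>) v - scalar_prod \<mu> v)))
           = of_real (exp (- (dir_variance A v * t\<^sup>2) / 2))"
    and "0 \<le> dir_variance A v"
proof -
  have X: "X \<in> measurable M (borel_vec d)" using G by (simp add: gaussian_vector_def)
  have Xi [measurable]: "(\<lambda>\<omega>. vec_index (X \<omega>) i) \<in> borel_measurable M" if "i < d" for i
    using measurable_compose[OF X measurable_borel_vec_component[OF that]] .
  define Z where "Z \<omega> = scalar_prod (X \<omega>) v" for \<omega>
  have Z [measurable]: "Z \<in> borel_measurable M"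
    unfolding Z_def using measurable_compose[OF X measurable_borel_vec_scalar_prod[OF v]] .
  obtain m s where s: "0 \<le> s" and distr: "distr M borel Z = normal_law m s"
    using G v unfolding gaussian_vector_def Z_def by blast
  note N = normal_law_moments[OF Z s distr]
  have Zsum: "Z \<omega> = (\<Sum>i<d. vec_index (X \<omega>) i * vec_index v i)" for \<omega>
    using v by (simp add: Z_def scalar_prod_def lessThan_atLeast0)
  have int: "integrable M (\<lambda>\<omega>. vec_index (X \<omega>) i)"
    and ex: "expectation (\<lambda>\<omega>. vec_index (X \<omega>) i) = vec_index \<mu> i" if "i < d" for i
    using mean that by (auto simp: has_mean_def)
  have "expectation Z = (\<Sum>i<d. vec_index \<mu> i * vec_index v i)"
    unfolding Zsum by (subst Bochner_Integration.integral_sum) (use int ex in auto)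
  also have "\<dots> = scalar_prod \<mu> v" using v by (simp add: scalar_prod_def lessThan_atLeast0)
  finally have m: "m = scalar_prod \<mu> v" "expectation Z = scalar_prod \<mu> v" using N(1) by auto
  define cr where "cr i j \<omega> = (vec_index (X \<omega>) i - vec_index \<mu> i) * (vec_index (X \<omega>) j - vec_index \<mu> j)" for i j \<omega>
  have cr: "integrable M (cr i j)" "expectation (cr i j) = A $$ (i, j)" if "i < d" "j < d" for i j
    using cov that ex unfolding has_covariance_def Let_def cr_def by auto
  have A: "A \<in> carrier_mat d d" using cov by (simp add: has_covariance_def)
  have "variance Z = expectation (\<lambda>\<omega>. \<Sum>i<d. \<Sum>j<d. vec_index v i * vec_index v j * cr i j \<omega>)"
  proof (rule Bochner_Integration.integral_cong[OF refl])
    fix \<omega>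
    have "Z \<omega> - expectation Z = (\<Sum>i<d. vec_index v i * (vec_index (X \<omega>) i - vec_index \<mu> i))"
      unfolding m(2) Zsum using v
      by (simp add: scalar_prod_def lessThan_atLeast0 algebra_simps sum_subtractf)
    thus "(Z \<omega> - expectation Z)\<^sup>2 = (\<Sum>i<d. \<Sum>j<d. vec_index v i * vec_index v j * cr i j \<omega>)"
      by (simp add: power2_eq_square sum_product cr_def mult_ac)
  qed
  also have "\<dots> = (\<Sum>i<d. \<Sum>j<d. vec_index v i * vec_index v j * A $$ (i, j))"
  proof -
    have i1: "integrable M (\<lambda>\<omega>. vec_index v i * vec_index v j * cr i j \<omega>)" if "i < d" "j < d" for i j
      using cr(1)[OF that] by simp
    have i2: "integrable M (\<lambda>\<omega>. \<Sum>j<d. vec_index v i * vec_index v j * cr i j \<omega>)" if "i < d" for i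
      using i1 that by (intro Bochner_Integration.integrable_sum) auto
    have e1: "expectation (\<lambda>\<omega>. \<Sum>j<d. vec_index v i * vec_index v j * cr i j \<omega>)
        = (\<Sum>j<d. vec_index v i * vec_index v j * A $$ (i, j))" if "i < d" for i
      using i1 that cr by (subst Bochner_Integration.integral_sum) auto
    show ?thesis using i2 e1 by (subst Bochner_Integration.integral_sum) auto
  qed
  also have "\<dots> = dir_variance A v"
    using A v unfolding dir_variance_def scalar_prod_def
    by (simp add: lessThan_atLeast0 scalar_prod_def sum_distrib_left sum_distrib_right mult_ac)
  finally have var: "s\<^sup>2 = dir_variance A v" using N(2) by simp
  show "(CLINT \<omega>|M. iexp (t * (scalar_prod (X \<omega>) v - scalar_prod \<mu> v)))
           = of_real (exp (- (dir_variance A v * t\<^sup>2) / 2))"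
    using N(3)[of t] unfolding m(1) var Z_def .
  show "0 \<le> dir_variance A v" unfolding var[symmetric] by simp
qed

lemma covariance_matrix_symmetric:
  assumes "has_covariance M d X A"
  shows "transpose_mat A = A"
proof (rule eq_matI)
  fix i j assume "i < dim_row A" "j < dim_col A"
  hence ij: "i < d" "j < d" and A: "A \<in> carrier_mat d d"
    using assms by (auto simp: has_covariance_def)
  define e where "e k \<omega> = vec_index (X \<omega>) k - integral\<^sup>L M (\<lambda>\<omega>. vec_index (X \<omega>) k)" for k \<omega>
  have "A $$ (j, i) = integral\<^sup>L M (\<lambda>\<omega>. e j \<omega> * e i \<omega>)" "A $$ (i, j) = integral\<^sup>L M (\<lambda>\<omega>. e i \<omega> * e j \<omega>)"
    using assms ij unfolding has_covariance_def Let_def e_def by auto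
  hence "A $$ (j, i) = A $$ (i, j)" by (simp only: mult.commute)
  thus "transpose_mat A $$ (i, j) = A $$ (i, j)" using ij A by simp
qed (use assms in \<open>auto simp: has_covariance_def\<close>)

lemma empirical_mean_projection:
  assumes X: "\<And>i. i \<in> {1..N} \<Longrightarrow> X i \<omega> \<in> carrier_vec d" and \<mu>: "\<mu> \<in> carrier_vec d"
    and u: "u \<in> carrier_vec d" and N: "N \<ge> 1"
  shows "scalar_prod (empirical_mean d N X \<omega> - \<mu>) u
           = (\<Sum>i\<in>{1..N}. (scalar_prod (X i \<omega>) u - scalar_prod \<mu> u) / real N)"
proof -
  have "scalar_prod (empirical_mean d N X \<omega>) u = (\<Sum>j<d. (\<Sum>i=1..N. vec_index (X i \<omega>) j * vec_index u j / real N))"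
    using u by (simp add: empirical_mean_def scalar_prod_def lessThan_atLeast0 sum_distrib_right sum_divide_distrib)
  also have "\<dots> = (\<Sum>i=1..N. (\<Sum>j<d. vec_index (X i \<omega>) j * vec_index u j / real N))"
    by (rule sum.swap)
  also have "\<dots> = (\<Sum>i=1..N. scalar_prod (X i \<omega>) u / real N)"
    using u X by (simp add: scalar_prod_def lessThan_atLeast0 sum_divide_distrib)
  finally show ?thesis
    using \<mu> u N minus_scalar_prod_distrib[of "empirical_mean d N X \<omega>" d \<mu> u]
    by (simp add: empirical_mean_def diff_divide_distrib sum_subtractf)
qed

lemma empirical_mean_characteristic_function:
  assumes S: "gaussian_sample M d N \<mu> A X" and N: "N \<ge> 1" and u: "u \<in> carrier_vec d"
  shows "(\<lambda>\<omega>. scalar_prod (empirical_mean d N X \<omega> - \<mu>) u) \<in> borel_measurable M"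
    and "(CLINT \<omega>|M. iexp (scalar_prod (empirical_mean d N X \<omega> - \<mu>) u))
           = of_real (exp (- (dir_variance A u / real N) / 2))"
proof -
  interpret prob_space M using S by (simp add: gaussian_sample_def)
  have G: "gaussian_vector M d (X i)" "has_mean M d (X i) \<mu>" "has_covariance M d (X i) A"
    and X: "X i \<in> measurable M (borel_vec d)" if "i \<in> {1..N}" for i
    using S that by (auto simp: gaussian_sample_def gaussian_vector_def)
  have ind: "indep_vars (\<lambda>_. borel_vec d) X {1..N}" using S by (simp add: gaussian_sample_def)
  have \<mu>: "\<mu> \<in> carrier_vec d" using G(2)[of 1] N by (simp add: has_mean_def)
  define p where "p x = (scalar_prod x u - scalar_prod \<mu> u) / real N" for x :: rvec
  have p [measurable]: "p \<in> borel_measurable (borel_vec d)"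
    unfolding p_def using measurable_borel_vec_scalar_prod[OF u] by measurable
  have eq: "scalar_prod (empirical_mean d N X \<omega> - \<mu>) u = (\<Sum>i\<in>{1..N}. p (X i \<omega>))"
    if \<omega>: "\<omega> \<in> space M" for \<omega>
    unfolding p_def
    by (rule empirical_mean_projection[OF _ \<mu> u N]) (use measurable_space[OF X \<omega>] in \<open>simp add: space_borel_vec\<close>)
  have pX [measurable]: "(\<lambda>\<omega>. p (X i \<omega>)) \<in> borel_measurable M" if "i \<in> {1..N}" for i
    using measurable_compose[OF X[OF that] p] .
  show "(\<lambda>\<omega>. scalar_prod (empirical_mean d N X \<omega> - \<mu>) u) \<in> borel_measurable M"
    using eq by (subst measurable_cong[of M _ "\<lambda>\<omega>. \<Sum>i\<in>{1..N}. p (X i \<omega>)"]) auto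
  have "(CLINT \<omega>|M. iexp (scalar_prod (empirical_mean d N X \<omega> - \<mu>) u))
      = (CLINT \<omega>|M. iexp (1 * (\<Sum>i\<in>{1..N}. p (X i \<omega>))))"
    by (rule Bochner_Integration.integral_cong) (simp_all add: eq)
  also have "\<dots> = char (distr M borel (\<lambda>\<omega>. \<Sum>i\<in>{1..N}. p (X i \<omega>))) 1"
    unfolding char_def by (rule integral_distr[symmetric]) auto
  also have "\<dots> = (\<Prod>i\<in>{1..N}. char (distr M borel (\<lambda>\<omega>. p (X i \<omega>))) 1)"
    by (rule char_distr_sum, rule indep_vars_compose2[OF ind]) (rule p)
  also have "\<dots> = (\<Prod>i\<in>{1..N}. of_real (exp (- (dir_variance A u * (1 / real N)\<^sup>2) / 2)))"
  proof (rule prod.cong[OF refl])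
    fix i assume i: "i \<in> {1..N}"
    have "char (distr M borel (\<lambda>\<omega>. p (X i \<omega>))) 1
        = (CLINT \<omega>|M. iexp ((1 / real N) * (scalar_prod (X i \<omega>) u - scalar_prod \<mu> u)))"
      unfolding char_def by (subst integral_distr[OF pX[OF i]]) (simp_all add: p_def)
    thus "char (distr M borel (\<lambda>\<omega>. p (X i \<omega>))) 1 = of_real (exp (- (dir_variance A u * (1 / real N)\<^sup>2) / 2))"
      using gaussian_vector_projection(1)[OF G[OF i] u, of "1 / real N"] by simp
  qed
  also have "\<dots> = of_real (exp (real N * (- (dir_variance A u * (1 / real N)\<^sup>2) / 2)))"
    by (simp only: prod_constant card_atLeastAtMost exp_of_nat_mult of_real_power) simp
  also have "real N * (- (dir_variance A u * (1 / real N)\<^sup>2) / 2) = - (dir_variance A u / real N) / 2"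
    using N by (simp add: power2_eq_square field_simps)
  finally show "(CLINT \<omega>|M. iexp (scalar_prod (empirical_mean d N X \<omega> - \<mu>) u))
           = of_real (exp (- (dir_variance A u / real N) / 2))" .
qed

section \<open>The lower bound for the strong term\<close>

theorem proposition1:
  fixes C :: real
  assumes "C > 0"
  shows "\<exists>C'>0. \<forall>(d::nat) (S :: real \<Rightarrow> nat \<Rightarrow> rvec \<Rightarrow> rmat \<Rightarrow> real).
    (\<forall>\<delta> N \<mu> \<Sigma> (M :: 'a measure) X.
       0 < \<delta> \<and> \<delta> < 1 \<and> 1 \<le> N \<and> gaussian_sample M d N \<mu> \<Sigma> X \<longrightarrow>
       measure M {\<omega> \<in> space M. \<forall>u \<in> unit_sphere d.
         scalar_prod (empirical_mean d N X \<omega> - \<mu>) u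
           \<le> C * sqrt (dir_variance \<Sigma> u * ln (1 / \<delta>) / real N) + S \<delta> N \<mu> \<Sigma>} \<ge> 1 - \<delta>)
    \<longrightarrow>
    (\<forall>\<delta> N \<mu> \<Sigma> (M :: 'a measure) X lam.
       0 < \<delta> \<and> \<delta> \<le> 1/2 \<and> 1 \<le> N \<and> gaussian_sample M d N \<mu> \<Sigma> X \<and>
       ordered_eigenvalues d \<Sigma> lam \<and> k_zero C \<delta> < real d \<longrightarrow>
       S \<delta> N \<mu> \<Sigma> \<ge> C' * sqrt ((\<Sum>i \<in> {i \<in> {1..d}. k_zero C \<delta> < real i}. lam i) / real N))"
proof (intro exI[of _ "1 / (2 * (sqrt 2 * C + 1))"] conjI allI impI)
  show "1 / (2 * (sqrt 2 * C + 1)) > 0" using assms by (simp add: add_pos_pos)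
next
  fix d :: nat and S :: "real \<Rightarrow> nat \<Rightarrow> rvec \<Rightarrow> rmat \<Rightarrow> real"
    and \<delta> :: real and N :: nat and \<mu> :: rvec and A :: rmat and M :: "'a measure"
    and X :: "nat \<Rightarrow> 'a \<Rightarrow> rvec" and lam :: "nat \<Rightarrow> real"
  assume bound: "\<forall>\<delta> N \<mu> \<Sigma> (M :: 'a measure) X.
       0 < \<delta> \<and> \<delta> < 1 \<and> 1 \<le> N \<and> gaussian_sample M d N \<mu> \<Sigma> X \<longrightarrow>
       measure M {\<omega> \<in> space M. \<forall>u \<in> unit_sphere d.
         scalar_prod (empirical_mean d N X \<omega> - \<mu>) u
           \<le> C * sqrt (dir_variance \<Sigma> u * ln (1 / \<delta>) / real N) + S \<delta> N \<mu> \<Sigma>} \<ge> 1 - \<delta>"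
    and asm: "0 < \<delta> \<and> \<delta> \<le> 1/2 \<and> 1 \<le> N \<and> gaussian_sample M d N \<mu> A X \<and>
       ordered_eigenvalues d A lam \<and> k_zero C \<delta> < real d"
  hence \<delta>: "0 < \<delta>" "\<delta> \<le> 1/2" and N: "1 \<le> N" and sample: "gaussian_sample M d N \<mu> A X"
    and eig: "ordered_eigenvalues d A lam" and k: "k_zero C \<delta> < real d" by auto
  define L where "L = ln (1 / \<delta>)"
  have L: "ln 2 \<le> L" unfolding L_def using \<delta> by (simp add: field_simps)
  interpret prob_space M using sample by (simp add: gaussian_sample_def)
  have X1: "gaussian_vector M d (X 1)" "has_mean M d (X 1) \<mu>" "has_covariance M d (X 1) A"
    using sample N by (auto simp: gaussian_sample_def)
  have A: "A \<in> carrier_mat d d" using X1(3) by (simp add: has_covariance_def)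
  have \<mu>: "\<mu> \<in> carrier_vec d" using X1(2) by (simp add: has_mean_def)
  have "char_poly A = (\<Prod>e\<leftarrow>map lam [1..<Suc d]. [:- e, 1:])"
    using eig unfolding ordered_eigenvalues_def
    by (simp add: prod.distinct_set_conv_list[symmetric] atLeastLessThanSuc_atLeastAtMost o_def del: upt_Suc)
  from symmetric_orthogonal_diagonalization[OF A covariance_matrix_symmetric[OF X1(3)] this]
  obtain U where U: "U \<in> carrier_mat d d" and UU: "transpose_mat U * U = 1\<^sub>m d"
    and UA: "transpose_mat U * A * U = mat d d (\<lambda>(i, j). if i = j then map lam [1..<Suc d] ! i else 0)"
    by auto
  have UA: "transpose_mat U * A * U = mat d d (\<lambda>(i, j). if i = j then lam (Suc i) else 0)"
    unfolding UA by (intro eq_matI) (auto simp del: upt_Suc)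
  have UU: "transpose_mat U * 1\<^sub>m d * U = mat d d (\<lambda>(i, j). if i = j then 1 else 0)"
    using UU U by (simp add: one_mat_def[symmetric])
  \<comment> \<open>\<open>dir w\<close> is the vector with coordinates \<open>w 1, \<dots>, w d\<close> in the eigenbasis; the columns of \<open>U\<close> are
    numbered from 0.\<close>
  define dir where "dir w = U *\<^sub>v vec d (\<lambda>j. w (Suc j))" for w :: "nat \<Rightarrow> real"
  have dir: "dir w \<in> carrier_vec d" for w unfolding dir_def using U by auto
  have dir_norm: "scalar_prod (dir w) (dir w) = (\<Sum>i\<in>{1..d}. (w i)\<^sup>2)" for w
    using quadratic_form_diagonal[OF U _ _ UU, of "vec d (\<lambda>j. w (Suc j))"] dir[of w] U
    by (simp add: dir_def[symmetric] sum.atLeast1_atMost_eq)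
  have dir_var: "dir_variance A (dir w) = (\<Sum>i\<in>{1..d}. lam i * (w i)\<^sup>2)" for w
    using quadratic_form_diagonal[OF U A _ UA, of "vec d (\<lambda>j. w (Suc j))"]
    by (simp add: dir_def dir_variance_def sum.atLeast1_atMost_eq)
  define Y where "Y i \<omega> = scalar_prod (empirical_mean d N X \<omega> - \<mu>) (col U (i - 1))" for i \<omega>
  have dir_Y: "scalar_prod (empirical_mean d N X \<omega> - \<mu>) (dir w) = (\<Sum>i\<in>{1..d}. w i * Y i \<omega>)" for w \<omega>
    unfolding dir_def Y_def using \<mu>
    by (subst scalar_prod_mult_mat_vec[OF U]) (auto simp: sum.atLeast1_atMost_eq empirical_mean_def)
  have lam0: "0 \<le> lam i" if "i \<in> {1..d}" for i
  proof -
    have "dir_variance A (dir (\<lambda>j. if j = i then 1 else 0)) = lam i"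
      unfolding dir_var using that by (simp add: if_distrib[of "\<lambda>x. x\<^sup>2"] if_distrib[of "(*) _"] cong: if_cong)
    thus ?thesis using gaussian_vector_projection(2)[OF X1 dir] by metis
  qed
  define E where "E = {\<omega> \<in> space M. \<forall>u \<in> unit_sphere d.
         scalar_prod (empirical_mean d N X \<omega> - \<mu>) u \<le> C * sqrt (dir_variance A u * L / real N) + S \<delta> N \<mu> A}"
  have "prob E \<ge> 1 - \<delta>" unfolding E_def L_def using bound \<delta> N sample by auto
  hence E: "prob E \<ge> 1 / 2" using \<delta> by linarith
  \<comment> \<open>A set that is not measurable has measure 0 by convention, so the lower bound yields measurability.\<close>
  have Es: "E \<in> sets M"
  proof (rule ccontr)
    assume "E \<notin> sets M"
    thus False using measure_notin_sets[of E M] E by simp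
  qed
  have "1 / (2 * (sqrt 2 * C + 1)) * sqrt (\<Sum>i \<in> {i \<in> {1..d}. k_zero C \<delta> < real i}. lam i / real N) \<le> S \<delta> N \<mu> A"
  proof (rule gaussian_strong_term_lower_bound[where Y = Y and L = L, OF _ _ _ _ assms L _ k Es E])
    show "Y i \<in> borel_measurable M" if "i \<in> {1..d}" for i
      unfolding Y_def by (rule empirical_mean_characteristic_function(1)[OF sample N]) (use U that in auto)
    show "(CLINT \<omega>|M. iexp (\<Sum>i\<in>{1..d}. a i * Y i \<omega>))
        = of_real (exp (- (\<Sum>i\<in>{1..d}. lam i / real N * (a i)\<^sup>2) / 2))" for a
      using empirical_mean_characteristic_function(2)[OF sample N dir[of a]]
      unfolding dir_Y dir_var by (simp add: sum_divide_distrib)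
    show "lam j / real N \<le> lam i / real N" if "1 \<le> i" "i \<le> j" "j \<le> d" for i j
      using eig that by (intro divide_right_mono) (auto simp: ordered_eigenvalues_def)
    show "k_zero C \<delta> = 1 + (2 * C + sqrt 2)\<^sup>2 * L" by (simp add: k_zero_def L_def)
    show "(\<Sum>i\<in>{1..d}. w i * Y i \<omega>)
        \<le> C * sqrt ((\<Sum>i\<in>{1..d}. lam i / real N * (w i)\<^sup>2) * L) + S \<delta> N \<mu> A"
      if \<omega>: "\<omega> \<in> E" and w: "(\<Sum>i\<in>{1..d}. (w i)\<^sup>2) = 1" for \<omega> w
    proof -
      have "dir w \<in> unit_sphere d" using dir dir_norm w by (simp add: unit_sphere_def)
      hence "scalar_prod (empirical_mean d N X \<omega> - \<mu>) (dir w)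
          \<le> C * sqrt (dir_variance A (dir w) * L / real N) + S \<delta> N \<mu> A" using \<omega> by (simp add: E_def)
      thus ?thesis unfolding dir_Y dir_var by (simp add: sum_divide_distrib[symmetric])
    qed
  qed (use lam0 in auto)
  thus "1 / (2 * (sqrt 2 * C + 1)) * sqrt ((\<Sum>i \<in> {i \<in> {1..d}. k_zero C \<delta> < real i}. lam i) / real N)
      \<le> S \<delta> N \<mu> A"
    by (simp add: sum_divide_distrib)
qed

end
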